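(* In the setting of the context, suppose that the search regions considered by Algorithm SMECN are circular, i.e. for every node $u$ and every power $p$ used by SMECN at $u$, the region $F(u,p)$ is a disk centered at $\mathrm{Loc}(u)$. Then the communication graph constructed by SMECN is a subgraph of the communication graph constructed by MECN; that is, for every $u\in V$, the neighbor set $N(u)$ computed by SMECN at $u$ is contained in the neighbor set $N(u)$ computed by MECN at $u$.
   Context: Setting: $V$ is a finite set of nodes located at pairwise distinct points of the plane; $\mathrm{Loc}(v)$ is the location of $v$ and $d$ is Euclidean distance. Fix constants $t>0$, $n\ge 2$ and $c>0$. Transmitting from $u$ to $v$ takes power $p(u,v)=t\,d(u,v)^n$; a reception takes power $c$. $G'=(V,E')$ is a directed graph without self-loops, where $(u,v)\in E'$ means that $u$ can transmit to $v$ when $u$ uses the maximum power $p_{max}$ (this implies $t\,d(u,v)^n\le p_{max}$); $G'$ is assumed (strongly) connected. The region of the plane that can be reached from $u$ with power $p\le p_{max}$ is $F(u,p)$, with $F(u,p)\subseteq F(u,p')$ for $p\le p'$; for $v\neq u$, $(u,v)\in E'$ iff $\mathrm{Loc}(v)\in F(u,p_{max})$. The cost of a path $r=(u_0,\dots,u_k)$ is $C(r)=\sum_{i=0}^{k-1}(p(u_i,u_{i+1})+c)$, and its length is $|r|=k$. For a point $(x,y)$ of the plane, $C(u,(x,y))=t\,d(u,(x,y))^n+c$ and $C(u,w,(x,y))=t\,d(u,w)^n+t\,d(w,(x,y))^n+2c$. The relay region of $(u,w)$ is $R_{u\to w}=\{(x,y):C(u,w,(x,y))\le C(u,(x,y))\}$.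 An edge $(u,v)\in E'$ is 2-redundant if there is a path $r$ in $G'$ from $u$ to $v$ with $|r|=2$ and $C(r)\le C(u,v)$. Standing assumption: if $(u,v)\in E'$ and $\mathrm{Loc}(v)\in R_{u\to w}$ for a node $w\in V$, then $(u,v)$ is 2-redundant. Each algorithm, run at node $u$, uses an initial power $p_0$ and a function $\mathrm{Increase}$ on powers (with values at most $p_{max}$) such that $\mathrm{Increase}^k(p_0)=p_{max}$ for all sufficiently large $k$, and $F(u,p_0)\not\supseteq F(u,p_{max})$; the two algorithms need not use the same $p_0$ and $\mathrm{Increase}$. An intersection over an empty set of nodes of sets $F(u,p_{max})\setminus R_{u\to v}$ is taken to be $F(u,p_{max})$. The communication graph constructed by an algorithm is $(V,E)$ with $(u,v)\in E$ iff $v\in N(u)$. Algorithm SMECN at node $u$: 1. Set $p=p_0$, $A=\emptyset$, $\mathit{NonNbrs}=\emptyset$, $\eta=F(u,p_{max})$. 2. While $F(u,p)\not\supseteq\eta$ do: (a) $p:=\mathrm{Increase}(p)$; (b) $M:=\{v\in V:\mathrm{Loc}(v)\in F(u,p),\ v\notin A,\ v\ne u\}$; (c) $A:=A\cup M$; (d) for each $v\in M$ and each $w\in A$: if $\mathrm{Loc}(v)\in R_{u\to w}$ then $\mathit{NonNbrs}:=\mathit{NonNbrs}\cup\{v\}$, else if $\mathrm{Loc}(w)\in R_{u\to v}$ then $\mathit{NonNbrs}:=\mathit{NonNbrs}\cup\{w\}$; (e) $\eta:=\eta\cap\bigcap_{v\in M}\bigl(F(u,p_{max})\setminus R_{u\to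 v}\bigr)$. 3. Output $N(u)=A\setminus\mathit{NonNbrs}$. Algorithm MECN at node $u$: 1. Set $p=p_0$, $A=\emptyset$, $\mathit{NonNbrs}=\emptyset$, $\eta=F(u,p_{max})$. 2. While $F(u,p)\not\supseteq\eta$ do: (a) $p:=\mathrm{Increase}(p)$; (b) $M:=\{v\in V:\mathrm{Loc}(v)\in F(u,p),\ v\notin A,\ v\ne u\}$; (c) $A:=A\cup M$; (d) $\mathit{NonNbrs}:=\mathit{NonNbrs}\cup M$; (e) for each $v\in M$ (in some order) call $\mathrm{Flip}(v)$; (f) $\eta:=\bigcap_{v\in A\setminus\mathit{NonNbrs}}\bigl(F(u,p_{max})\setminus R_{u\to v}\bigr)$. 3. Output $N(u)=A\setminus\mathit{NonNbrs}$. Procedure $\mathrm{Flip}(v)$: if $v\notin\mathit{NonNbrs}$, then set $\mathit{NonNbrs}:=\mathit{NonNbrs}\cup\{v\}$ and call $\mathrm{Flip}(w)$ for each $w\in A$ with $\mathrm{Loc}(w)\in R_{u\to v}$; else, if $\mathrm{Loc}(v)\notin\bigcup_{w\in A\setminus\mathit{NonNbrs}}R_{u\to w}$, then set $\mathit{NonNbrs}:=\mathit{NonNbrs}\setminus\{v\}$ and call $\mathrm{Flip}(w)$ for each $w\in A$ with $\mathrm{Loc}(w)\in R_{u\to v}$; otherwise do nothing. *)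

theory Defs
  imports "Graph_Theory.Digraph_Component" "HOL-Analysis.Analysis"
begin

section \<open>Wireless networks\<close>

text \<open>
  The field \<open>max_graph\<close> is the graph \<open>G' = (V, E')\<close>; \<open>coeff\<close>, \<open>path_loss\<close> and \<open>recv_power\<close> are the
  constants \<open>t\<close>, \<open>n\<close> (a real number, hence \<open>powr\<close> below) and \<open>c\<close>; \<open>region W u p\<close> is \<open>F(u,p)\<close>, which
  has a meaning only for \<open>p \<le> max_power W\<close>.
\<close>

record 'v network =
  max_graph :: "'v pair_pre_digraph"
  loc :: "'v \<Rightarrow> real ^ 2"
  coeff :: real
  path_loss :: real
  recv_power :: real
  max_power :: real
  region :: "'v \<Rightarrow> real \<Rightarrow> (real ^ 2) set"

abbreviation nodes :: "'v network \<Rightarrow> 'v set" where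
  "nodes W \<equiv> pverts (max_graph W)"

definition tx_power :: "'v network \<Rightarrow> real ^ 2 \<Rightarrow> real ^ 2 \<Rightarrow> real" where
  "tx_power W x y = coeff W * dist x y powr path_loss W"

text \<open>As in \<^const>\<open>pre_digraph.awalk\<close>, a path is represented by the list of its edges.\<close>

definition path_cost :: "'v network \<Rightarrow> ('v \<times> 'v) list \<Rightarrow> real" where
  "path_cost W r = (\<Sum>(a, b) \<leftarrow> r. tx_power W (loc W a) (loc W b) + recv_power W)"

definition direct_cost :: "'v network \<Rightarrow> 'v \<Rightarrow> real ^ 2 \<Rightarrow> real" where
  "direct_cost W u x = tx_power W (loc W u) x + recv_power W"

definition relayed_cost :: "'v network \<Rightarrow> 'v \<Rightarrow> 'v \<Rightarrow> real ^ 2 \<Rightarrow> real" where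
  "relayed_cost W u w x =
     tx_power W (loc W u) (loc W w) + tx_power W (loc W w) x + 2 * recv_power W"

definition relay_region :: "'v network \<Rightarrow> 'v \<Rightarrow> 'v \<Rightarrow> (real ^ 2) set" where
  "relay_region W u w = {x. relayed_cost W u w x \<le> direct_cost W u x}"

definition two_redundant :: "'v network \<Rightarrow> 'v \<Rightarrow> 'v \<Rightarrow> bool" where
  "two_redundant W u v \<longleftrightarrow>
     (u, v) \<in> parcs (max_graph W) \<and>
     (\<exists>r. pre_digraph.awalk (with_proj (max_graph W)) u r v \<and> length r = 2 \<and>
          path_cost W r \<le> path_cost W [(u, v)])"

locale wireless_network =
  fixes W :: "'v network"
  assumes max_graph: "pair_digraph (max_graph W)"
    and connected: "strongly_connected (with_proj (max_graph W))"
    and inj_loc: "inj_on (loc W) (nodes W)"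
    and coeff_pos: "0 < coeff W"
    and path_loss_ge: "2 \<le> path_loss W"
    and recv_power_pos: "0 < recv_power W"
    and edge_power: "\<And>u v. (u, v) \<in> parcs (max_graph W) \<Longrightarrow>
      tx_power W (loc W u) (loc W v) \<le> max_power W"
    and region_mono: "\<And>u p p'. \<lbrakk>u \<in> nodes W; p \<le> p'; p' \<le> max_power W\<rbrakk> \<Longrightarrow>
      region W u p \<subseteq> region W u p'"
    and edge_iff: "\<And>u v. \<lbrakk>u \<in> nodes W; v \<in> nodes W; v \<noteq> u\<rbrakk> \<Longrightarrow>
      (u, v) \<in> parcs (max_graph W) \<longleftrightarrow> loc W v \<in> region W u (max_power W)"
    and relay_redundant: "\<And>u v w. \<lbrakk>(u, v) \<in> parcs (max_graph W); w \<in> nodes W;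
      loc W v \<in> relay_region W u w\<rbrakk> \<Longrightarrow> two_redundant W u v"


section \<open>Search parameters and search states\<close>

text \<open>The initial power and the function \<open>Increase\<close> may depend on the node running the algorithm.\<close>

record 'v search =
  init_power :: "'v \<Rightarrow> real"
  increase :: "'v \<Rightarrow> real \<Rightarrow> real"

definition valid_search :: "'v network \<Rightarrow> 'v search \<Rightarrow> bool" where
  "valid_search W S \<longleftrightarrow>
     (\<forall>u \<in> nodes W.
        init_power S u \<le> max_power W \<and>
        (\<forall>p \<le> max_power W. increase S u p \<le> max_power W) \<and>
        (\<exists>K. \<forall>k \<ge> K. (increase S u ^^ k) (init_power S u) = max_power W) \<and>
        \<not> region W u (max_power W) \<subseteq> region W u (init_power S u))"

text \<open>The program variables \<open>p\<close>, \<open>A\<close>, \<open>NonNbrs\<close> and \<open>\<eta>\<close>.\<close>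

record 'v search_state =
  cur_power :: real
  found :: "'v set"
  non_nbrs :: "'v set"
  uncovered :: "(real ^ 2) set"

text \<open>The intersection with \<open>F(u, p\<^sub>m\<^sub>a\<^sub>x)\<close> matters only for \<open>X = {}\<close>, where it realises the convention for
  empty intersections.\<close>

definition relay_free :: "'v network \<Rightarrow> 'v \<Rightarrow> 'v set \<Rightarrow> (real ^ 2) set" where
  "relay_free W u X =
     region W u (max_power W) \<inter> (\<Inter>v \<in> X. region W u (max_power W) - relay_region W u v)"

definition new_nodes :: "'v network \<Rightarrow> 'v \<Rightarrow> real \<Rightarrow> 'v set \<Rightarrow> 'v set" where
  "new_nodes W u p A = {v \<in> nodes W. loc W v \<in> region W u p \<and> v \<notin> A \<and> v \<noteq> u}"

text \<open>\<open>foreach B X s s'\<close>: executing the possibly nondeterministic body \<open>B\<close> once for each element of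
  the set \<open>X\<close>, in some order, can turn the state \<open>s\<close> into \<open>s'\<close>.\<close>

inductive foreach :: "('a \<Rightarrow> 's \<Rightarrow> 's \<Rightarrow> bool) \<Rightarrow> 'a set \<Rightarrow> 's \<Rightarrow> 's \<Rightarrow> bool"
  for B where
  empty: "foreach B {} s s"
| step: "\<lbrakk>x \<in> X; B x s s'; foreach B (X - {x}) s' s''\<rbrakk> \<Longrightarrow> foreach B X s s''"

lemma foreach_mono [mono]:
  assumes "\<And>x s s'. B x s s' \<longrightarrow> B' x s s'"
  shows "foreach B X s s' \<longrightarrow> foreach B' X s s'"
proof
  assume "foreach B X s s'"
  then show "foreach B' X s s'"
    by induction (use assms in \<open>auto intro: foreach.intros\<close>)
qed

text \<open>The states at the head of the while loop with body \<open>B\<close> in runs at node \<open>u\<close>, and the outputs of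
  terminating runs.\<close>

inductive loop_state ::
  "'v network \<Rightarrow> 'v search \<Rightarrow> 'v \<Rightarrow> ('v search_state \<Rightarrow> 'v search_state \<Rightarrow> bool) \<Rightarrow>
   'v search_state \<Rightarrow> bool"
  for W S u B where
  init: "loop_state W S u B
           \<lparr>cur_power = init_power S u, found = {}, non_nbrs = {},
            uncovered = region W u (max_power W)\<rparr>"
| step: "\<lbrakk>loop_state W S u B s; \<not> uncovered s \<subseteq> region W u (cur_power s); B s s'\<rbrakk> \<Longrightarrow>
         loop_state W S u B s'"

definition loop_output ::
  "'v network \<Rightarrow> 'v search \<Rightarrow> 'v \<Rightarrow> ('v search_state \<Rightarrow> 'v search_state \<Rightarrow> bool) \<Rightarrow>
   'v set \<Rightarrow> bool" where
  "loop_output W S u B N \<longleftrightarrow>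
     (\<exists>s. loop_state W S u B s \<and> uncovered s \<subseteq> region W u (cur_power s) \<and>
          N = found s - non_nbrs s)"


section \<open>Algorithm SMECN\<close>

definition smecn_mark :: "'v network \<Rightarrow> 'v \<Rightarrow> 'v \<times> 'v \<Rightarrow> 'v set \<Rightarrow> 'v set \<Rightarrow> bool" where
  "smecn_mark W u = (\<lambda>(v, w) NN NN'.
     NN' = (if loc W v \<in> relay_region W u w then NN \<union> {v}
            else if loc W w \<in> relay_region W u v then NN \<union> {w}
            else NN))"

definition smecn_body ::
  "'v network \<Rightarrow> 'v search \<Rightarrow> 'v \<Rightarrow> 'v search_state \<Rightarrow> 'v search_state \<Rightarrow> bool" where
  "smecn_body W S u s s' \<longleftrightarrow>
     (let p = increase S u (cur_power s);
          M = new_nodes W u p (found s);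
          A = found s \<union> M
      in cur_power s' = p \<and> found s' = A \<and>
         foreach (smecn_mark W u) (M \<times> A) (non_nbrs s) (non_nbrs s') \<and>
         uncovered s' = uncovered s \<inter> relay_free W u M)"

abbreviation smecn_state :: "'v network \<Rightarrow> 'v search \<Rightarrow> 'v \<Rightarrow> 'v search_state \<Rightarrow> bool" where
  "smecn_state W S u \<equiv> loop_state W S u (smecn_body W S u)"

abbreviation smecn_output :: "'v network \<Rightarrow> 'v search \<Rightarrow> 'v \<Rightarrow> 'v set \<Rightarrow> bool" where
  "smecn_output W S u \<equiv> loop_output W S u (smecn_body W S u)"


section \<open>Algorithm MECN\<close>

text \<open>\<open>flip W u A v NN NN'\<close>: with \<open>A\<close> the set of nodes found so far, a call of \<open>Flip(v)\<close> can change
  \<open>NonNbrs\<close> from \<open>NN\<close> to \<open>NN'\<close>. The order of the recursive calls is arbitrary.\<close>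

inductive flip :: "'v network \<Rightarrow> 'v \<Rightarrow> 'v set \<Rightarrow> 'v \<Rightarrow> 'v set \<Rightarrow> 'v set \<Rightarrow> bool"
  for W u A where
  insert: "\<lbrakk>v \<notin> NN;
            foreach (flip W u A) {w \<in> A. loc W w \<in> relay_region W u v} (NN \<union> {v}) NN'\<rbrakk> \<Longrightarrow>
           flip W u A v NN NN'"
| remove: "\<lbrakk>v \<in> NN; loc W v \<notin> (\<Union>w \<in> A - NN. relay_region W u w);
            foreach (flip W u A) {w \<in> A. loc W w \<in> relay_region W u v} (NN - {v}) NN'\<rbrakk> \<Longrightarrow>
           flip W u A v NN NN'"
| skip: "\<lbrakk>v \<in> NN; loc W v \<in> (\<Union>w \<in> A - NN. relay_region W u w)\<rbrakk> \<Longrightarrow>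
         flip W u A v NN NN"

definition mecn_body ::
  "'v network \<Rightarrow> 'v search \<Rightarrow> 'v \<Rightarrow> 'v search_state \<Rightarrow> 'v search_state \<Rightarrow> bool" where
  "mecn_body W S u s s' \<longleftrightarrow>
     (let p = increase S u (cur_power s);
          M = new_nodes W u p (found s);
          A = found s \<union> M
      in cur_power s' = p \<and> found s' = A \<and>
         foreach (flip W u A) M (non_nbrs s \<union> M) (non_nbrs s') \<and>
         uncovered s' = relay_free W u (A - non_nbrs s'))"

abbreviation mecn_output :: "'v network \<Rightarrow> 'v search \<Rightarrow> 'v \<Rightarrow> 'v set \<Rightarrow> bool" where
  "mecn_output W S u \<equiv> loop_output W S u (mecn_body W S u)"


section \<open>Communication graphs and disks\<close>

definition comm_graph :: "'v network \<Rightarrow> ('v \<Rightarrow> 'v set) \<Rightarrow> 'v pair_pre_digraph" where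
  "comm_graph W N = \<lparr>pverts = nodes W, parcs = {(u, v). u \<in> nodes W \<and> v \<in> N u}\<rparr>"

definition is_disk :: "real ^ 2 \<Rightarrow> (real ^ 2) set \<Rightarrow> bool" where
  "is_disk a D \<longleftrightarrow> (\<exists>r \<ge> 0. D = cball a r) \<or> (\<exists>r > 0. D = ball a r)"


section \<open>Termination\<close>

text \<open>Both algorithms have a terminating run at every node, so that statements about all their
  outputs are not vacuous.\<close>

lemma foreach_total:
  assumes "finite X" and "\<And>x s. x \<in> X \<Longrightarrow> \<exists>s'. B x s s'"
  shows "\<exists>s'. foreach B X s s'"
  using assms
proof (induction X arbitrary: s rule: finite_induct)
  case empty
  show ?case by (blast intro: foreach.empty)
next
  case (insert x X)
  obtain s' where "B x s s'" using insert.prems by blast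
  moreover obtain s'' where "foreach B X s' s''" using insert.IH insert.prems by blast
  moreover have "insert x X - {x} = X" using insert.hyps by auto
  ultimately show ?case by (metis foreach.step insertI1)
qed

context wireless_network
begin

lemma relay_region_farther:
  assumes "x \<in> relay_region W u w"
  shows "dist (loc W u) (loc W w) < dist (loc W u) x"
proof (rule ccontr)
  assume "\<not> ?thesis"
  then have "dist (loc W u) x powr path_loss W \<le> dist (loc W u) (loc W w) powr path_loss W"
    using path_loss_ge by (intro powr_mono2) auto
  then have "tx_power W (loc W u) x \<le> tx_power W (loc W u) (loc W w)"
    using coeff_pos by (simp add: tx_power_def)
  moreover have "0 \<le> tx_power W (loc W w) x"
    using coeff_pos by (simp add: tx_power_def)
  ultimately show False
    using assms recv_power_pos by (simp add: relay_region_def relayed_cost_def direct_cost_def)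
qed

lemma flip_total:
  assumes "finite A"
  shows "\<exists>NN'. flip W u A v NN NN'"
proof (induction "card {w \<in> A. dist (loc W u) (loc W v) < dist (loc W u) (loc W w)}"
    arbitrary: v NN rule: less_induct)
  case less
  let ?D = "\<lambda>v. {w \<in> A. dist (loc W u) (loc W v) < dist (loc W u) (loc W w)}"
  let ?R = "{w \<in> A. loc W w \<in> relay_region W u v}"
  have "\<exists>NN'. flip W u A w NN NN'" if "w \<in> ?R" for w NN
  proof -
    have "dist (loc W u) (loc W v) < dist (loc W u) (loc W w)"
      using that relay_region_farther by blast
    then have "?D w \<subset> ?D v" using that by auto
    then have "card (?D w) < card (?D v)"
      using assms by (intro psubset_card_mono) auto
    then show ?thesis using less by blast
  qed
  then have rec: "\<exists>NN'. foreach (flip W u A) ?R NN NN'" for NN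
    using assms by (intro foreach_total) auto
  consider "v \<notin> NN"
    | "v \<in> NN" "loc W v \<notin> (\<Union>w \<in> A - NN. relay_region W u w)"
    | "v \<in> NN" "loc W v \<in> (\<Union>w \<in> A - NN. relay_region W u w)"
    by blast
  then show ?case
  proof cases
    case 1
    obtain NN' where "foreach (flip W u A) ?R (NN \<union> {v}) NN'" using rec ..
    with 1 have "flip W u A v NN NN'" by (rule flip.insert)
    then show ?thesis ..
  next
    case 2
    obtain NN' where "foreach (flip W u A) ?R (NN - {v}) NN'" using rec ..
    with 2 have "flip W u A v NN NN'" by (rule flip.remove)
    then show ?thesis ..
  next
    case 3
    then have "flip W u A v NN NN" by (rule flip.skip)
    then show ?thesis ..
  qed
qed

lemma finite_nodes: "finite (nodes W)"
  using max_graph by (simp add: pair_digraph_def pair_fin_digraph_def pair_fin_digraph_axioms_def)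

lemma loop_terminates:
  assumes S: "valid_search W S" and u: "u \<in> nodes W"
    and cur_power: "\<And>s s'. B s s' \<Longrightarrow> cur_power s' = increase S u (cur_power s)"
    and found: "\<And>s s'. \<lbrakk>B s s'; found s \<subseteq> nodes W\<rbrakk> \<Longrightarrow> found s' \<subseteq> nodes W"
    and uncovered: "\<And>s s'. \<lbrakk>B s s'; uncovered s \<subseteq> region W u (max_power W)\<rbrakk> \<Longrightarrow>
      uncovered s' \<subseteq> region W u (max_power W)"
    and total: "\<And>s. found s \<subseteq> nodes W \<Longrightarrow> \<exists>s'. B s s'"
  shows "\<exists>N. loop_output W S u B N"
proof -
  have *: "(\<exists>N. loop_output W S u B N) \<or>
    (\<exists>s. loop_state W S u B s \<and> cur_power s = (increase S u ^^ k) (init_power S u) \<and>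
       found s \<subseteq> nodes W \<and> uncovered s \<subseteq> region W u (max_power W))" for k
  proof (induction k)
    case 0
    show ?case
      by (intro disjI2 exI conjI, rule loop_state.init) auto
  next
    case (Suc k)
    show ?case
    proof (cases "\<exists>N. loop_output W S u B N")
      case False
      then obtain s where s: "loop_state W S u B s"
        "cur_power s = (increase S u ^^ k) (init_power S u)"
        "found s \<subseteq> nodes W" "uncovered s \<subseteq> region W u (max_power W)"
        using Suc by blast
      then have "\<not> uncovered s \<subseteq> region W u (cur_power s)"
        using False by (force simp: loop_output_def)
      moreover obtain s' where s': "B s s'" using total s by blast
      ultimately have "loop_state W S u B s'" using s by (blast intro: loop_state.step)
      then show ?thesis using cur_power[OF s'] found[OF s'] uncovered[OF s'] s by auto
    qed simp
  qed
  obtain K where "(increase S u ^^ K) (init_power S u) = max_power W"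
    using S u unfolding valid_search_def by blast
  then show ?thesis using *[of K] unfolding loop_output_def by metis
qed

lemma relay_free_subset: "relay_free W u X \<subseteq> region W u (max_power W)"
  by (auto simp: relay_free_def)

lemma smecn_terminates:
  assumes "valid_search W S" "u \<in> nodes W"
  shows "\<exists>N. smecn_output W S u N"
proof (rule loop_terminates[OF assms])
  fix s :: "'v search_state"
  assume A: "found s \<subseteq> nodes W"
  let ?p = "increase S u (cur_power s)"
  let ?M = "new_nodes W u ?p (found s)"
  have "finite ?M" "finite (found s)"
    using A finite_nodes by (auto simp: new_nodes_def intro: finite_subset)
  then obtain NN where
    "foreach (smecn_mark W u) (?M \<times> (found s \<union> ?M)) (non_nbrs s) NN"
    using foreach_total[of "?M \<times> (found s \<union> ?M)" "smecn_mark W u" "non_nbrs s"]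
    by (auto simp: smecn_mark_def)
  then have "smecn_body W S u s \<lparr>cur_power = ?p, found = found s \<union> ?M, non_nbrs = NN,
      uncovered = uncovered s \<inter> relay_free W u ?M\<rparr>"
    by (simp add: smecn_body_def Let_def)
  then show "\<exists>s'. smecn_body W S u s s'" ..
qed (auto simp: smecn_body_def Let_def new_nodes_def)

lemma mecn_terminates:
  assumes "valid_search W S" "u \<in> nodes W"
  shows "\<exists>N. mecn_output W S u N"
proof (rule loop_terminates[OF assms])
  fix s :: "'v search_state"
  assume A: "found s \<subseteq> nodes W"
  let ?p = "increase S u (cur_power s)"
  let ?M = "new_nodes W u ?p (found s)"
  let ?A = "found s \<union> ?M"
  have fin: "finite ?M" "finite ?A"
    using A finite_nodes by (auto simp: new_nodes_def intro: finite_subset)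
  then obtain NN where "foreach (flip W u ?A) ?M (non_nbrs s \<union> ?M) NN"
    using foreach_total[of ?M "flip W u ?A" "non_nbrs s \<union> ?M"] flip_total[of ?A u] by blast
  then have "mecn_body W S u s \<lparr>cur_power = ?p, found = ?A, non_nbrs = NN,
      uncovered = relay_free W u (?A - NN)\<rparr>"
    by (simp add: mecn_body_def Let_def)
  then show "\<exists>s'. mecn_body W S u s s'" ..
next
  fix s s' :: "'v search_state"
  assume "mecn_body W S u s s'"
  then show "uncovered s' \<subseteq> region W u (max_power W)"
    using relay_free_subset by (simp add: mecn_body_def Let_def)
qed (auto simp: mecn_body_def Let_def new_nodes_def)

end

end

theory Submission
  imports Defs
begin

text \<open>
  A relay region \<open>R\<^bsub>u\<rightarrow>w\<^esub>\<close> only contains points farther from \<open>u\<close> than \<open>w\<close>. With circular regions SMECN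
  therefore finds every \<open>w\<close> that relays to \<open>v\<close> no later than \<open>v\<close>, so its output only contains nodes
  that lie in no relay region at all. MECN cannot stop before it has found such a node, because the node
  is never covered; and MECN flips it exactly once, namely out of \<open>NonNbrs\<close> when it is found, because
  all other flips are triggered by membership in a relay region.
\<close>

lemma foreach_smecn_mark_mono:
  assumes "foreach (smecn_mark W u) X NN NN'"
  shows "NN \<subseteq> NN'"
  using assms
proof induction
  case (step x X s s' s'')
  have "s \<subseteq> s'"
    using step.hyps(2) by (cases x) (auto simp: smecn_mark_def split: if_splits)
  with step.IH show ?case by blast
qed simp

lemma foreach_smecn_mark_marks:
  assumes "foreach (smecn_mark W u) X NN NN'"
    and "(v, w) \<in> X" "loc W v \<in> relay_region W u w"
  shows "v \<in> NN'"
  using assms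
proof induction
  case (step x X s s' s'')
  show ?case
  proof (cases "x = (v, w)")
    case True
    then have "v \<in> s'" using step.hyps(2) step.prems(2) by (simp add: smecn_mark_def)
    then show ?thesis using foreach_smecn_mark_mono[OF step.hyps(3)] by blast
  next
    case False
    then show ?thesis using step by blast
  qed
qed simp

text \<open>Stated with an equivalence because other flips must neither add \<open>v\<close> to
  \<open>NonNbrs\<close> nor remove it.\<close>

lemma foreach_invariant:
  assumes "foreach B X s s'"
    and "\<And>x s s'. \<lbrakk>x \<in> X; B x s s'\<rbrakk> \<Longrightarrow> P s \<longleftrightarrow> P s'"
  shows "P s \<longleftrightarrow> P s'"
  using assms
proof induction
  case (step x X s s' s'')
  have "P s \<longleftrightarrow> P s'" using step.prems step.hyps(1,2) by blast
  moreover have "P s' \<longleftrightarrow> P s''" using step.prems by (intro step.IH) blast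
  ultimately show ?case by simp
qed simp

text \<open>The recursion started at \<open>x\<close> only visits nodes of \<open>A\<close> lying in
  the relay region of some node of \<open>A\<close>, so it never reaches \<open>v\<close>.\<close>

lemma flip_unrelayed_other:
  assumes "flip W u A x NN NN'"
    and "x \<in> A" "x \<noteq> v"
    and unrelayed: "\<And>w. w \<in> A \<Longrightarrow> loc W v \<notin> relay_region W u w"
  shows "v \<in> NN \<longleftrightarrow> v \<in> NN'"
  using assms(1-3)
proof (induction rule: flip.induct)
  case (insert x NN NN')
  have "v \<in> NN \<union> {x} \<longleftrightarrow> v \<in> NN'"
  \<comment> \<open>In \<open>insert.IH\<close> the loop body is the conjunction of
    \<open>flip\<close> and the induction hypothesis for the recursive call.\<close>
  proof (rule foreach_invariant[OF insert.IH, where P = "\<lambda>NN. v \<in> NN"])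
    fix w s s'
    assume "w \<in> {w \<in> A. loc W w \<in> relay_region W u x}"
    then have "w \<in> A" "w \<noteq> v" using unrelayed \<open>x \<in> A\<close> by auto
    moreover assume "flip W u A w s s' \<and> (w \<in> A \<longrightarrow> w \<noteq> v \<longrightarrow> (v \<in> s) = (v \<in> s'))"
    ultimately show "v \<in> s \<longleftrightarrow> v \<in> s'" by blast
  qed
  then show ?case using insert.prems by blast
next
  case (remove x NN NN')
  have "v \<in> NN - {x} \<longleftrightarrow> v \<in> NN'"
  proof (rule foreach_invariant[OF remove.IH, where P = "\<lambda>NN. v \<in> NN"])
    fix w s s'
    assume "w \<in> {w \<in> A. loc W w \<in> relay_region W u x}"
    then have "w \<in> A" "w \<noteq> v" using unrelayed \<open>x \<in> A\<close> by auto
    moreover assume "flip W u A w s s' \<and> (w \<in> A \<longrightarrow> w \<noteq> v \<longrightarrow> (v \<in> s) = (v \<in> s'))"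
    ultimately show "v \<in> s \<longleftrightarrow> v \<in> s'" by blast
  qed
  then show ?case using remove.prems by blast
qed simp

text \<open>As \<open>v\<close> is in \<open>NN\<close> and in no relay region, only the rule
  \<open>remove\<close> can apply. Its recursive calls leave \<open>v\<close> alone, since
  \<open>v\<close> is not in its own relay region either.\<close>

lemma flip_unrelayed_self:
  assumes "flip W u A v NN NN'" "v \<in> A" "v \<in> NN"
    and unrelayed: "\<And>w. w \<in> A \<Longrightarrow> loc W v \<notin> relay_region W u w"
  shows "v \<notin> NN'"
  using assms(1)
proof cases
  case remove
  have "v \<in> NN - {v} \<longleftrightarrow> v \<in> NN'"
  proof (rule foreach_invariant[OF remove(3), where P = "\<lambda>NN. v \<in> NN"])
    fix x s s'
    assume x: "x \<in> {w \<in> A. loc W w \<in> relay_region W u v}" and flip: "flip W u A x s s'"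
    have "x \<in> A" "x \<noteq> v" using x unrelayed[OF \<open>v \<in> A\<close>] by auto
    with flip show "v \<in> s \<longleftrightarrow> v \<in> s'" using unrelayed by (rule flip_unrelayed_other)
  qed
  then show ?thesis by simp
next
  case insert
  then show ?thesis using \<open>v \<in> NN\<close> by blast
next
  case skip
  then show ?thesis using unrelayed by blast
qed

text \<open>The invariant is that \<open>v\<close> is in \<open>NonNbrs\<close> exactly as long as
  its own flip is pending. It treats alike a \<open>v\<close> found in this round, found earlier or
  not found yet.\<close>

lemma foreach_flip_unrelayed:
  assumes "foreach (flip W u A) X NN NN'"
    and "X \<subseteq> A" "v \<in> X \<longleftrightarrow> v \<in> NN"
    and unrelayed: "\<And>w. w \<in> A \<Longrightarrow> loc W v \<notin> relay_region W u w"
  shows "v \<notin> NN'"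
  using assms(1-3)
proof induction
  case (step x X s s' s'')
  have "v \<in> X - {x} \<longleftrightarrow> v \<in> s'"
  proof (cases "x = v")
    case True
    then show ?thesis
      using flip_unrelayed_self[of W u A v s s'] step.hyps(1,2) step.prems unrelayed by blast
  next
    case False
    then show ?thesis
      using flip_unrelayed_other[of W u A x s s' v] step.hyps(1,2) step.prems unrelayed by blast
  qed
  with step show ?case by blast
qed simp

lemma is_disk_closer:
  assumes "is_disk a D" "x \<in> D" "dist a y \<le> dist a x"
  shows "y \<in> D"
  using assms by (auto simp: is_disk_def)

text \<open>This bound is what allows \<open>region_mono\<close> to be applied, which is assumed
  only up to \<open>max_power\<close>.\<close>

lemma loop_state_cur_power_le:
  assumes "loop_state W S u B s" "valid_search W S" "u \<in> nodes W"
    and "\<And>s s'. B s s' \<Longrightarrow> cur_power s' = increase S u (cur_power s)"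
  shows "cur_power s \<le> max_power W"
  using assms by induction (auto simp: valid_search_def)

lemma smecn_state_found_subset:
  assumes "smecn_state W S u s"
  shows "found s \<subseteq> nodes W - {u}"
  using assms by induction (auto simp: smecn_body_def Let_def new_nodes_def)

lemma mecn_state_found_subset:
  assumes "loop_state W S u (mecn_body W S u) s"
  shows "found s \<subseteq> nodes W"
  using assms by induction (auto simp: mecn_body_def Let_def new_nodes_def)

lemma mecn_state_unrelayed:
  assumes "loop_state W S u (mecn_body W S u) s"
    and unrelayed: "\<And>w. w \<in> nodes W \<Longrightarrow> loc W v \<notin> relay_region W u w"
  shows "v \<notin> non_nbrs s"
  using assms(1)
proof induction
  case (step s s')
  let ?M = "new_nodes W u (increase S u (cur_power s)) (found s)"
  have "foreach (flip W u (found s \<union> ?M)) ?M (non_nbrs s \<union> ?M) (non_nbrs s')"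
    using step.hyps(3) by (simp add: mecn_body_def Let_def)
  moreover have "w \<in> nodes W" if "w \<in> found s \<union> ?M" for w
    using that mecn_state_found_subset[OF step.hyps(1)] by (auto simp: new_nodes_def)
  \<comment> \<open>By the induction hypothesis \<open>v\<close> is not in
    \<open>non_nbrs s\<close>, so it is in \<open>non_nbrs s \<union> ?M\<close> iff it is in
    \<open>?M\<close>.\<close>
  ultimately show ?case
    using foreach_flip_unrelayed[of W u _ ?M _ _ v] step.IH unrelayed by blast
qed simp

lemma mecn_terminal_found:
  assumes "valid_search W S" "u \<in> nodes W"
    and "loop_state W S u (mecn_body W S u) s" "uncovered s \<subseteq> region W u (cur_power s)"
    and v: "v \<in> nodes W" "v \<noteq> u" "loc W v \<in> region W u (max_power W)"
    and unrelayed: "\<And>w. w \<in> nodes W \<Longrightarrow> loc W v \<notin> relay_region W u w"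
  shows "v \<in> found s"
  using assms(3)
proof cases
  \<comment> \<open>The loop cannot stop at once: \<open>valid_search\<close> says that the initial
    power does not cover the full region.\<close>
  case init
  then show ?thesis using assms by (auto simp: valid_search_def)
next
  case (step s0)
  \<comment> \<open>No relay region removes the location of \<open>v\<close> from \<eta>, so the
    final region contains it and the last round found \<open>v\<close> unless an earlier one
    did.\<close>
  have "loc W v \<in> uncovered s"
    using step(3) v unrelayed mecn_state_found_subset[OF assms(3)]
    by (auto simp: mecn_body_def Let_def relay_free_def)
  then show ?thesis
    using assms(4) step(3) v by (auto simp: mecn_body_def Let_def new_nodes_def)
qed

context wireless_network
begin

text \<open>Relaying through \<open>u\<close> itself costs one extra reception. This rules out
  \<open>w = u\<close> below, as \<open>u\<close> never finds itself.\<close>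

lemma not_in_own_relay_region: "x \<notin> relay_region W u u"
  using recv_power_pos path_loss_ge
  by (simp add: relay_region_def relayed_cost_def direct_cost_def tx_power_def)

lemma smecn_state_reachable:
  assumes "smecn_state W S u s" "valid_search W S" "u \<in> nodes W" "v \<in> found s"
  shows "loc W v \<in> region W u (max_power W)"
  using assms(1,4)
proof induction
  case (step s s')
  have "smecn_state W S u s'" using step.hyps by (rule loop_state.step)
  then have "cur_power s' \<le> max_power W"
    using assms(2,3) by (rule loop_state_cur_power_le) (simp add: smecn_body_def Let_def)
  then have "region W u (cur_power s') \<subseteq> region W u (max_power W)"
    using region_mono assms(3) by blast
  then show ?case
    using step by (auto simp: smecn_body_def Let_def new_nodes_def)
qed simp

lemma smecn_state_relayed_marked:
  assumes "smecn_state W S u s"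
    and circular: "\<And>s. smecn_state W S u s \<Longrightarrow> is_disk (loc W u) (region W u (cur_power s))"
    and "v \<in> found s" "w \<in> nodes W" "loc W v \<in> relay_region W u w"
  shows "v \<in> non_nbrs s"
  using assms(1,3)
proof induction
  case (step s s')
  let ?M = "new_nodes W u (cur_power s') (found s)"
  have body: "found s' = found s \<union> ?M"
      "foreach (smecn_mark W u) (?M \<times> (found s \<union> ?M)) (non_nbrs s) (non_nbrs s')"
    using step.hyps(3) by (simp_all add: smecn_body_def Let_def)
  show ?case
  proof (cases "v \<in> found s")
    case True
    then show ?thesis using step.IH foreach_smecn_mark_mono[OF body(2)] by blast
  next
    case False
    then have v: "v \<in> ?M" using step.prems body(1) by blast
    have "smecn_state W S u s'" using step.hyps by (rule loop_state.step)
    then have "is_disk (loc W u) (region W u (cur_power s'))" by (rule circular)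
    moreover have "loc W v \<in> region W u (cur_power s')" using v by (simp add: new_nodes_def)
    \<comment> \<open>A relay is closer to \<open>u\<close> than \<open>v\<close>, so the disk that
      reveals \<open>v\<close> also contains \<open>w\<close>, and the pair \<open>(v, w)\<close> is
      examined in this very round.\<close>
    ultimately have "loc W w \<in> region W u (cur_power s')"
      by (rule is_disk_closer) (use relay_region_farther[OF assms(5)] in simp)
    moreover have "w \<noteq> u" using assms(5) not_in_own_relay_region by blast
    ultimately have "w \<in> found s \<union> ?M" using assms(4) by (simp add: new_nodes_def)
    then show ?thesis using foreach_smecn_mark_marks[OF body(2)] v assms(5) by blast
  qed
qed simp

theorem smecn_output_subset_mecn_output:
  assumes S: "valid_search W S" and M: "valid_search W M" and u: "u \<in> nodes W"
    and circular: "\<And>s. smecn_state W S u s \<Longrightarrow> is_disk (loc W u) (region W u (cur_power s))"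
    and smecn: "smecn_output W S u N" and mecn: "mecn_output W M u N'"
  shows "N \<subseteq> N'"
proof
  fix v
  assume "v \<in> N"
  with smecn obtain s where s: "smecn_state W S u s" "v \<in> found s" "v \<notin> non_nbrs s"
    by (auto simp: loop_output_def)
  \<comment> \<open>All nodes \<open>w\<close> are needed here: MECN, with its own powers, may find
    nodes that SMECN never found.\<close>
  have unrelayed: "loc W v \<notin> relay_region W u w" if "w \<in> nodes W" for w
    using smecn_state_relayed_marked[OF s(1) circular s(2) that] s(3) by blast
  have v: "v \<in> nodes W" "v \<noteq> u" "loc W v \<in> region W u (max_power W)"
    using s smecn_state_found_subset[OF s(1)] smecn_state_reachable[OF s(1) S u] by auto
  from mecn obtain s' where s': "loop_state W M u (mecn_body W M u) s'"
      "uncovered s' \<subseteq> region W u (cur_power s')" "N' = found s' - non_nbrs s'"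
    by (auto simp: loop_output_def)
  show "v \<in> N'"
    using mecn_terminal_found[OF M u s'(1,2) v unrelayed] mecn_state_unrelayed[OF s'(1) unrelayed]
      s'(3) by blast
qed

text \<open>Needed because \<open>subgraph\<close> includes well-formedness: arcs must end in
  nodes.\<close>

lemma mecn_output_subset_nodes:
  assumes "mecn_output W M u N"
  shows "N \<subseteq> nodes W"
  using assms mecn_state_found_subset by (fastforce simp: loop_output_def)

end

lemma subgraph_comm_graph:
  assumes "\<And>u. u \<in> nodes W \<Longrightarrow> N u \<subseteq> N' u" "\<And>u. u \<in> nodes W \<Longrightarrow> N' u \<subseteq> nodes W"
  shows "subgraph (with_proj (comm_graph W N)) (with_proj (comm_graph W N'))"
  using assms
  by (auto simp: subgraph_def compatible_def comm_graph_def wf_digraph_def)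

theorem mainTheorem4:
  fixes W :: "'v network" and S M :: "'v search" and NS NM :: "'v \<Rightarrow> 'v set"
  assumes "wireless_network W"
    and "valid_search W S"
    and "valid_search W M"
    and circular: "\<And>u s. \<lbrakk>u \<in> nodes W; smecn_state W S u s\<rbrakk> \<Longrightarrow>
      is_disk (loc W u) (region W u (cur_power s))"
    and "\<And>u. u \<in> nodes W \<Longrightarrow> smecn_output W S u (NS u)"
    and "\<And>u. u \<in> nodes W \<Longrightarrow> mecn_output W M u (NM u)"
  shows "subgraph (with_proj (comm_graph W NS)) (with_proj (comm_graph W NM)) \<and>
    (\<forall>u \<in> nodes W. NS u \<subseteq> NM u)"
proof -
  interpret wireless_network W by fact
  have *: "NS u \<subseteq> NM u" if "u \<in> nodes W" for u
    using smecn_output_subset_mecn_output[OF assms(2,3) that circular[OF that]] assms(5,6) that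
    by blast
  moreover have "NM u \<subseteq> nodes W" if "u \<in> nodes W" for u
    using mecn_output_subset_nodes assms(6) that by blast
  ultimately show ?thesis using subgraph_comm_graph by blast
qed

end
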